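(* Let $s:\mathbb{Z}^2\to S^3\subset\mathbb{R}P^4$ be a discrete Königs net in the Möbius quadric. Suppose that $s$ admits an affine projection, i.e. there are $\mathfrak q\in\mathbb{R}^{4,1}\setminus\{0\}$ and $\mathfrak s:\mathbb{Z}^2\to\mathfrak Q^3$ with $s_i=\mathbb{R}\,\mathfrak s_i$, $(\mathfrak s_i,\mathfrak s_i)=0$ and $(\mathfrak s_i,\mathfrak q)=1$ for all $i\in\mathbb{Z}^2$, so that the Königs dual $\mathfrak s^\ast$ of $\mathfrak s$ takes values in a concentric quadric $\mathfrak Q^3_{r,t}$ of $\mathfrak Q^3$ (for some $r,t\in\mathbb{R}$). Then $\mathfrak s$ has constant mean curvature $H$, that is, there are a Gauss map $\mathfrak n$ of $\mathfrak s$ and a constant $H\in\mathbb{R}$ such that $A(\mathfrak n,\mathfrak s)_{ijkl}=-H\,A(\mathfrak s,\mathfrak s)_{ijkl}$ on every elementary quadrilateral $(ijkl)$ of $\mathbb{Z}^2$.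
   Context: $\mathbb{R}^{4,1}$ is $\mathbb{R}^5$ with a Minkowski inner product $(\cdot,\cdot)$ of signature $(4,1)$, serving as space of homogeneous coordinates of $\mathbb{R}P^4$. Put $\mathcal L^4_t=\{y\in\mathbb{R}^{4,1}: (y,y)=t\}$ and $\mathcal L^4=\mathcal L^4_0$; the Möbius quadric is $S^3=P(\mathcal L^4)\subset\mathbb{R}P^4$. For $\mathfrak q\neq0$ put $\mathfrak E^4_r=\{y\in\mathbb{R}^{4,1}:(y,\mathfrak q)=r\}$ and $\mathfrak E^4=\mathfrak E^4_1$. The quadric $\mathfrak Q^3=\mathcal L^4\cap\mathfrak E^4$ has constant sectional curvature $\kappa=-(\mathfrak q,\mathfrak q)$. Its concentric quadrics are $\mathfrak Q^3_{r,t}=\mathcal L^4_t\cap\mathfrak E^4_r$; in particular $\mathfrak Q^3=\mathfrak Q^3_{1,0}$. A discrete conjugate net is a map on $\mathbb{Z}^2$ such that the four vertices of each elementary quadrilateral (face) $(ijkl)$, with vertices listed cyclically, are coplanar. A discrete Königs net is a discrete conjugate net such that at each vertex the four intersection points of the diagonals of the four incident faces are coplanar. For a vector valued map $g$ on $\mathbb{Z}^2$ write $dg_{ij}=g_j-g_i$ for edges $(ij)$ and $\delta g_{ik}=g_k-g_i$ for diagonals. Two conjugate nets $\mathfrak s,\mathfrak s^\ast$, in the same or in parallel affine spaces, are Königs dual if they are edge-parallel and have parallel non-corresponding diagonals: on every edge $d\mathfrak s^\ast_{ij}=c_{ij}\,d\mathfrak s_{ij}$ with $c_{ij}\in\mathbb{R}\setminus\{0\}$,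 and on every face $\delta\mathfrak s^\ast_{ik}\wedge\delta\mathfrak s_{jl}=0$ and $\delta\mathfrak s_{ik}\wedge\delta\mathfrak s^\ast_{jl}=0$. Königs duality is invariant under translations of $\mathfrak s^\ast$. The mixed area of two edge-parallel nets on a face is $A(\mathfrak s,\mathfrak n)_{ijkl}=\frac14\{\delta\mathfrak s_{ik}\wedge\delta\mathfrak n_{jl}+\delta\mathfrak n_{ik}\wedge\delta\mathfrak s_{jl}\}\in\Lambda^2\mathbb{R}^{4,1}$. A Gauss map of $\mathfrak s:\mathbb{Z}^2\to\mathfrak Q^3$ is a map $\mathfrak n:\mathbb{Z}^2\to\mathbb{R}^{4,1}$ with $(\mathfrak n,\mathfrak n)\equiv1$, $\mathfrak n_i\in T_{\mathfrak s_i}\mathfrak Q^3=\{\mathfrak s_i,\mathfrak q\}^\perp$ at all vertices, and $d\mathfrak n_{ij}+k_{ij}\,d\mathfrak s_{ij}=0$ on every edge for some $k_{ij}\in\mathbb{R}$. The mean curvature $H$ of $(\mathfrak s,\mathfrak n)$ is the function on faces defined by $A(\mathfrak n,\mathfrak s)=-H\,A(\mathfrak s,\mathfrak s)$.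
   Formalization: The formal theorem additionally assumes that A(s,s) is nonzero on at least one elementary quadrilateral; without this, nets whose faces are all crossed isosceles trapezoids are their own Königs dual and give counterexamples. *)

theory Defs
  imports "HOL-Analysis.Analysis"
begin

section \<open>Minkowski space and its quadrics\<close>

text \<open>The standard model of the Minkowski space of signature (4,1). In the index type \<open>5\<close>
  the five distinct indices are \<open>1, 2, 3, 4, 5\<close> (with \<open>5 = 0\<close>).\<close>

type_synonym R41 = "real ^ 5"

definition mink :: "R41 \<Rightarrow> R41 \<Rightarrow> real" where
  "mink x y = x$1 * y$1 + x$2 * y$2 + x$3 * y$3 + x$4 * y$4 - x$5 * y$5"

definition quadric_L :: "real \<Rightarrow> R41 set" where
  "quadric_L t = {y. mink y y = t}"

definition hyperplane_E :: "R41 \<Rightarrow> real \<Rightarrow> R41 set" where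
  "hyperplane_E \<qq> r = {y. mink y \<qq> = r}"

definition concentric_quadric :: "R41 \<Rightarrow> real \<Rightarrow> real \<Rightarrow> R41 set" where
  "concentric_quadric \<qq> r t = quadric_L t \<inter> hyperplane_E \<qq> r"

definition space_form :: "R41 \<Rightarrow> R41 set" where
  "space_form \<qq> = concentric_quadric \<qq> 1 0"

definition tangent_space_form :: "R41 \<Rightarrow> R41 \<Rightarrow> R41 set" where
  "tangent_space_form \<qq> p = {v. mink v p = 0 \<and> mink v \<qq> = 0}"

text \<open>Points of the projective space are the one-dimensional linear subspaces.\<close>

definition proj_points :: "R41 set set" where
  "proj_points = {P. subspace P \<and> dim P = 1}"

definition moebius_quadric :: "R41 set set" where
  "moebius_quadric = {P \<in> proj_points. P \<subseteq> quadric_L 0}"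

text \<open>A projective plane is a linear subspace of dimension 3; \<^term>\<open>dim\<close> of a set is the
  dimension of its span.\<close>

definition proj_coplanar :: "R41 set set \<Rightarrow> bool" where
  "proj_coplanar X \<longleftrightarrow> dim (\<Union>X) \<le> 3"

definition proj_join :: "R41 set \<Rightarrow> R41 set \<Rightarrow> R41 set" where
  "proj_join P Q = span (P \<union> Q)"

section \<open>Combinatorics of the square lattice\<close>

type_synonym vertex = "int \<times> int"

definition edge :: "vertex \<Rightarrow> vertex \<Rightarrow> bool" where
  "edge i j \<longleftrightarrow> \<bar>fst i - fst j\<bar> + \<bar>snd i - snd j\<bar> = 1"

text \<open>The elementary quadrilaterals are exactly the 4-cycles of the lattice graph. Every
  elementary quadrilateral occurs with all eight cyclic listings of its vertices.\<close>

definition face :: "vertex \<Rightarrow> vertex \<Rightarrow> vertex \<Rightarrow> vertex \<Rightarrow> bool" where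
  "face i j k l \<longleftrightarrow> edge i j \<and> edge j k \<and> edge k l \<and> edge l i \<and> i \<noteq> k \<and> j \<noteq> l"

section \<open>Conjugate nets and Koenigs nets in projective space\<close>

definition proj_conjugate_net :: "(vertex \<Rightarrow> R41 set) \<Rightarrow> bool" where
  "proj_conjugate_net s \<longleftrightarrow>
     range s \<subseteq> proj_points \<and>
     (\<forall>i j k l. face i j k l \<longrightarrow> proj_coplanar {s i, s j, s k, s l})"

definition diagonal_intersection ::
    "(vertex \<Rightarrow> R41 set) \<Rightarrow> vertex \<Rightarrow> vertex \<Rightarrow> vertex \<Rightarrow> vertex \<Rightarrow> R41 set" where
  "diagonal_intersection s i j k l = proj_join (s i) (s k) \<inter> proj_join (s j) (s l)"

text \<open>The second conjunct says that the diagonals of each face do meet in a single point.\<close>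

definition koenigs_net :: "(vertex \<Rightarrow> R41 set) \<Rightarrow> bool" where
  "koenigs_net s \<longleftrightarrow>
     proj_conjugate_net s \<and>
     (\<forall>i j k l. face i j k l \<longrightarrow> diagonal_intersection s i j k l \<in> proj_points) \<and>
     (\<forall>i. proj_coplanar {diagonal_intersection s i j k l | j k l. face i j k l})"

section \<open>Vector valued nets, Koenigs duality and mean curvature\<close>

definition diff :: "(vertex \<Rightarrow> R41) \<Rightarrow> vertex \<Rightarrow> vertex \<Rightarrow> R41" where
  "diff g i j = g j - g i"

text \<open>The exterior square is modelled by the skew-symmetric matrices, with
  \<open>u \<and> v\<close> corresponding to \<open>u v\<^sup>T - v u\<^sup>T\<close>.\<close>

definition wedge :: "R41 \<Rightarrow> R41 \<Rightarrow> real ^ 5 ^ 5" where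
  "wedge u v = (\<chi> a b. u$a * v$b - v$a * u$b)"

definition conjugate_net :: "(vertex \<Rightarrow> R41) \<Rightarrow> bool" where
  "conjugate_net g \<longleftrightarrow> (\<forall>i j k l. face i j k l \<longrightarrow> coplanar {g i, g j, g k, g l})"

text \<open>That the two nets lie in the same or in parallel affine spaces is a consequence of
  edge-parallelism.\<close>

definition koenigs_dual :: "(vertex \<Rightarrow> R41) \<Rightarrow> (vertex \<Rightarrow> R41) \<Rightarrow> bool" where
  "koenigs_dual g h \<longleftrightarrow>
     conjugate_net g \<and> conjugate_net h \<and>
     (\<forall>i j. edge i j \<longrightarrow> (\<exists>c. c \<noteq> 0 \<and> diff h i j = c *\<^sub>R diff g i j)) \<and>
     (\<forall>i j k l. face i j k l \<longrightarrow>
        wedge (diff h i k) (diff g j l) = 0 \<and> wedge (diff g i k) (diff h j l) = 0)"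

definition mixed_area ::
    "(vertex \<Rightarrow> R41) \<Rightarrow> (vertex \<Rightarrow> R41) \<Rightarrow> vertex \<Rightarrow> vertex \<Rightarrow> vertex \<Rightarrow> vertex \<Rightarrow> real ^ 5 ^ 5"
  where
  "mixed_area g h i j k l =
     (1/4) *\<^sub>R (wedge (diff g i k) (diff h j l) + wedge (diff h i k) (diff g j l))"

definition gauss_map :: "R41 \<Rightarrow> (vertex \<Rightarrow> R41) \<Rightarrow> (vertex \<Rightarrow> R41) \<Rightarrow> bool" where
  "gauss_map \<qq> \<ss> \<nn> \<longleftrightarrow>
     (\<forall>i. mink (\<nn> i) (\<nn> i) = 1) \<and>
     (\<forall>i. \<nn> i \<in> tangent_space_form \<qq> (\<ss> i)) \<and>
     (\<forall>i j. edge i j \<longrightarrow> (\<exists>k. diff \<nn> i j + k *\<^sub>R diff \<ss> i j = 0))"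

end

theory Submission
  imports Defs
begin

text \<open>Since \<open>\<ss>\<close> and \<open>\<ss>*\<close> are edge-parallel and both have constant norm, the inner product
  \<open>m = (\<ss>\<^sub>i, \<ss>*\<^sub>i)\<close> does not depend on \<open>i\<close>. Hence there is a constant \<open>a\<close> such that
  \<open>\<ss>* + a \<ss> - m \<qq>\<close> is tangent to the space form, and this vector has constant norm. As tangent
  spaces are positive definite, the norm vanishes only if \<open>\<ss>*\<close> is a translate of a multiple of
  \<open>\<ss>\<close>; then duality would force the two diagonals of every face to be parallel. Otherwise a
  constant multiple \<open>\<nn> = \<mu> (\<ss>* + a \<ss> - m \<qq>)\<close> is a Gauss map, and \<open>A(\<ss>*, \<ss>) = 0\<close> yields
  \<open>H = - \<mu> a\<close>.\<close>

lemma mink_sym: "mink x y = mink y x"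
  by (simp add: mink_def algebra_simps)

lemma mink_simps:
  "mink (x + y) z = mink x z + mink y z" "mink z (x + y) = mink z x + mink z y"
  "mink (x - y) z = mink x z - mink y z" "mink z (x - y) = mink z x - mink z y"
  "mink (c *\<^sub>R x) z = c * mink x z" "mink z (c *\<^sub>R x) = c * mink z x"
  by (simp_all add: mink_def algebra_simps)

lemma wedge_simps:
  "wedge (x + y) z = wedge x z + wedge y z" "wedge z (x + y) = wedge z x + wedge z y"
  "wedge (c *\<^sub>R x) z = c *\<^sub>R wedge x z" "wedge z (c *\<^sub>R x) = c *\<^sub>R wedge z x"
  by (simp_all add: wedge_def vec_eq_iff algebra_simps)

lemma diff_simps:
  "diff (\<lambda>i. g i + h i) i j = diff g i j + diff h i j"
  "diff (\<lambda>i. g i - p) i j = diff g i j"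
  "diff (\<lambda>i. c *\<^sub>R g i) i j = c *\<^sub>R diff g i j"
  by (simp_all add: diff_def algebra_simps)

lemma mixed_area_simps:
  "mixed_area (\<lambda>i. g i + h i) f i j k l = mixed_area g f i j k l + mixed_area h f i j k l"
  "mixed_area (\<lambda>i. g i - p) f i j k l = mixed_area g f i j k l"
  "mixed_area (\<lambda>i. c *\<^sub>R g i) f i j k l = c *\<^sub>R mixed_area g f i j k l"
  by (simp_all add: mixed_area_def diff_simps wedge_simps algebra_simps)

lemma koenigs_dual_mixed_area_zero:
  assumes "koenigs_dual g h" "face i j k l"
  shows "mixed_area h g i j k l = 0"
proof -
  have "wedge (diff h i k) (diff g j l) = 0" "wedge (diff g i k) (diff h j l) = 0"
    using assms unfolding koenigs_dual_def by blast+
  then show ?thesis by (simp add: mixed_area_def)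
qed

lemma exhaust_5: "x = 1 \<or> x = 2 \<or> x = 3 \<or> x = 4 \<or> x = 5" for x :: 5
proof (induct x)
  case (of_int z)
  then have "z = 0 \<or> z = 1 \<or> z = 2 \<or> z = 3 \<or> z = 4" by auto
  then show ?case by auto
qed

text \<open>Since \<open>p\<close> is isotropic and orthogonal to \<open>v\<close>, adding a
  multiple of \<open>p\<close> to \<open>v\<close> does not change the norm. The combination
  \<open>w\<close> removes the timelike coordinate, so that \<open>mink w w\<close> is a Euclidean
  sum of squares and equals \<open>(p$5)\<^sup>2 * mink v v\<close>.\<close>

lemma mink_tangent_pos:
  assumes p: "p \<in> space_form q" and v: "v \<in> tangent_space_form q p" and "v \<noteq> 0"
  shows "mink v v > 0"
proof -
  have pp: "mink p p = 0" and pq: "mink p q = 1" and vp: "mink v p = 0" and vq: "mink v q = 0"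
    using p v
    by (auto simp: space_form_def concentric_quadric_def quadric_L_def hyperplane_E_def
        tangent_space_form_def)
  define w where "w = p$5 *\<^sub>R v - v$5 *\<^sub>R p"
  \<comment> \<open>An isotropic vector without timelike part is zero, which
    \<open>mink p q = 1\<close> excludes.\<close>
  have p5: "p$5 \<noteq> 0"
  proof
    assume "p$5 = 0"
    with pp have "p$1 = 0 \<and> p$2 = 0 \<and> p$3 = 0 \<and> p$4 = 0"
      by (simp add: mink_def add_nonneg_eq_0_iff)
    with \<open>p$5 = 0\<close> pq show False by (simp add: mink_def)
  qed
  have "w$5 = 0" by (simp add: w_def)
  have "mink w w = (p$5)\<^sup>2 * mink v v"
    by (simp add: w_def mink_simps vp pp mink_sym[of p v] power2_eq_square)
  then have sum: "(p$5)\<^sup>2 * mink v v = (w$1)\<^sup>2 + (w$2)\<^sup>2 + (w$3)\<^sup>2 + (w$4)\<^sup>2"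
    using \<open>w$5 = 0\<close> by (simp add: mink_def power2_eq_square)
  \<comment> \<open>Pairing \<open>w\<close> with \<open>q\<close> isolates \<open>v$5\<close>,
    because \<open>v\<close> is orthogonal to \<open>q\<close> and
    \<open>mink p q = 1\<close>.\<close>
  have "w \<noteq> 0"
  proof
    assume "w = 0"
    then have "mink w q = 0" by (simp add: mink_def)
    then have "v$5 = 0" by (simp add: w_def mink_simps pq vq)
    with \<open>w = 0\<close> p5 \<open>v \<noteq> 0\<close> show False by (simp add: w_def)
  qed
  then obtain n where "w$n \<noteq> 0" by (auto simp: vec_eq_iff)
  then have "w$1 \<noteq> 0 \<or> w$2 \<noteq> 0 \<or> w$3 \<noteq> 0 \<or> w$4 \<noteq> 0"
    using \<open>w$5 = 0\<close> exhaust_5[of n] by auto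
  then have "(w$1)\<^sup>2 + (w$2)\<^sup>2 + (w$3)\<^sup>2 + (w$4)\<^sup>2 > 0"
    by (elim disjE) (simp_all add: add_pos_nonneg add_nonneg_pos)
  with sum have "(p$5)\<^sup>2 * mink v v > 0" by simp
  then show ?thesis by (simp add: zero_less_mult_iff)
qed

text \<open>The lattice graph is connected: a path runs horizontally to the column \<open>0\<close>
  and then along it to the origin.\<close>

lemma edge_invariant_const:
  assumes step: "\<And>i j. edge i j \<Longrightarrow> f i = f j"
  shows "f i = f (0, 0)"
proof -
  have "f (x, y) = f (0, y)" for x y
  proof (induction x rule: int_induct[where k = 0])
    case (step1 x)
    then show ?case using step[of "(x + 1, y)" "(x, y)"] by (simp add: edge_def)
  next
    case (step2 x)
    then show ?case using step[of "(x - 1, y)" "(x, y)"] by (simp add: edge_def)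
  qed simp
  moreover have "f (0, y) = f (0, 0)" for y
  proof (induction y rule: int_induct[where k = 0])
    case (step1 y)
    then show ?case using step[of "(0, y + 1)" "(0, y)"] by (simp add: edge_def)
  next
    case (step2 y)
    then show ?case using step[of "(0, y - 1)" "(0, y)"] by (simp add: edge_def)
  qed simp
  ultimately show ?thesis by (metis surj_pair)
qed

text \<open>Constant norm makes the sum of the endpoints of an edge orthogonal to their difference.
  Parallelism with \<open>c \<noteq> 0\<close> lets \<open>g\<close> and \<open>h\<close> exchange
  their differences here, and the two mixed relations add up to twice the change of
  \<open>mink (h i) (g i)\<close> along the edge.\<close>

lemma mink_edge_parallel_const:
  assumes dual: "\<And>i j. edge i j \<Longrightarrow> \<exists>c. c \<noteq> 0 \<and> diff h i j = c *\<^sub>R diff g i j"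
    and g: "\<And>i. mink (g i) (g i) = t" and h: "\<And>i. mink (h i) (h i) = t'"
  shows "\<exists>m. \<forall>i. mink (h i) (g i) = m"
proof -
  have "mink (h i) (g i) = mink (h j) (g j)" if "edge i j" for i j
  proof -
    obtain c where c: "c \<noteq> 0" and hg: "diff h i j = c *\<^sub>R diff g i j"
      using dual[OF \<open>edge i j\<close>] by blast
    have "c * mink (h i + h j) (diff g i j) = mink (h i + h j) (diff h i j)"
      by (simp add: hg mink_simps)
    also have "\<dots> = 0"
      by (simp add: diff_def mink_simps h mink_sym[of "h j" "h i"])
    finally have 1: "mink (h i + h j) (diff g i j) = 0" using c by simp
    have "mink (g i + g j) (diff h i j) = c * mink (g i + g j) (diff g i j)"
      by (simp add: hg mink_simps)
    also have "\<dots> = 0"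
      by (simp add: diff_def mink_simps g mink_sym[of "g j" "g i"])
    finally have 2: "mink (g i + g j) (diff h i j) = 0" .
    from 1 2 show ?thesis
      by (simp add: diff_def mink_simps mink_sym[of "g _" "h _"])
  qed
  then show ?thesis
    using edge_invariant_const[of "\<lambda>i. mink (h i) (g i)"] by blast
qed

text \<open>If \<open>b = 0\<close>, then \<open>h\<close> is constant and the nonzero edge factors
  collapse \<open>g\<close> to a point on each face. Otherwise translation invariance and linearity
  turn A(h,g) = 0 into b A(g,g) = 0.\<close>

lemma koenigs_dual_homothetic_degenerate:
  assumes dual: "koenigs_dual g h" and hom: "\<And>i. h i = b *\<^sub>R g i + p"
    and face: "face i j k l"
  shows "mixed_area g g i j k l = 0"
proof (cases "b = 0")
  case True
  have const: "g i' = g j'" if "edge i' j'" for i' j'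
  proof -
    obtain c where "c \<noteq> 0" "diff h i' j' = c *\<^sub>R diff g i' j'"
      using dual \<open>edge i' j'\<close> unfolding koenigs_dual_def by blast
    then show ?thesis by (simp add: diff_def hom True)
  qed
  have "g i = g j" "g j = g k" "g k = g l"
    using face const by (auto simp: face_def)
  then show ?thesis by (simp add: mixed_area_def diff_def wedge_def vec_eq_iff)
next
  case False
  \<comment> \<open>The translation is written as a subtraction to match
    \<open>mixed_area_simps\<close>.\<close>
  have "h = (\<lambda>i. b *\<^sub>R g i - (- p))" by (simp add: hom fun_eq_iff)
  then have "b *\<^sub>R mixed_area g g i j k l = mixed_area h g i j k l"
    by (simp only: mixed_area_simps)
  also have "\<dots> = 0" using dual face by (rule koenigs_dual_mixed_area_zero)
  finally show ?thesis using False by simp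
qed

theorem mainTheorem1:
  fixes s :: "vertex \<Rightarrow> R41 set"
    and \<qq> :: R41
    and \<ss> \<ss>_dual :: "vertex \<Rightarrow> R41"
    and r t :: real
  assumes koenigs: "koenigs_net s"
    and moebius: "\<And>i. s i \<in> moebius_quadric"
    and q_nonzero: "\<qq> \<noteq> 0"
    and affine_projection: "\<And>i. \<ss> i \<in> space_form \<qq>" "\<And>i. s i = span {\<ss> i}"
    and dual: "koenigs_dual \<ss> \<ss>_dual"
    and dual_concentric: "\<And>i. \<ss>_dual i \<in> concentric_quadric \<qq> r t"
    and nondegenerate: "\<exists>i j k l. face i j k l \<and> mixed_area \<ss> \<ss> i j k l \<noteq> 0"
  shows "\<exists>\<nn> H. gauss_map \<qq> \<ss> \<nn> \<and>
           (\<forall>i j k l. face i j k l \<longrightarrow>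
              mixed_area \<nn> \<ss> i j k l = - H *\<^sub>R mixed_area \<ss> \<ss> i j k l)"
proof -
  have ss: "mink (\<ss> i) (\<ss> i) = 0" and sq: "mink (\<ss> i) \<qq> = 1" for i
    using affine_projection(1)[of i]
    by (auto simp: space_form_def concentric_quadric_def quadric_L_def hyperplane_E_def)
  have dd: "mink (\<ss>_dual i) (\<ss>_dual i) = t" and dq: "mink (\<ss>_dual i) \<qq> = r" for i
    using dual_concentric[of i]
    by (auto simp: concentric_quadric_def quadric_L_def hyperplane_E_def)
  have edge_dual: "\<exists>c. c \<noteq> 0 \<and> diff \<ss>_dual i j = c *\<^sub>R diff \<ss> i j" if "edge i j" for i j
    using dual that unfolding koenigs_dual_def by blast
  obtain m where m: "\<And>i. mink (\<ss>_dual i) (\<ss> i) = m"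
    using mink_edge_parallel_const[of \<ss>_dual \<ss>, OF edge_dual ss dd] by auto
  \<comment> \<open>The coefficient \<open>m\<close> of \<open>\<qq>\<close> gives orthogonality to
    \<open>\<ss> i\<close>; then orthogonality to \<open>\<qq>\<close> reads
    \<open>r + a - m * mink \<qq> \<qq> = 0\<close>. In the norm \<open>N\<close> the terms with
    \<open>a\<close> cancel.\<close>
  define a where "a = m * mink \<qq> \<qq> - r"
  define N where "N = t - 2 * m * r + m\<^sup>2 * mink \<qq> \<qq>"
  define \<nn>0 where "\<nn>0 = (\<lambda>i. (\<ss>_dual i + a *\<^sub>R \<ss> i) - m *\<^sub>R \<qq>)"
  have norm: "mink (\<nn>0 i) (\<nn>0 i) = N" for i
    by (simp add: \<nn>0_def N_def mink_simps dd dq sq ss m mink_sym[of "\<ss> i" "\<ss>_dual i"]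
        mink_sym[of \<qq> "\<ss> i"] mink_sym[of \<qq> "\<ss>_dual i"] power2_eq_square algebra_simps)
  have tangent: "\<nn>0 i \<in> tangent_space_form \<qq> (\<ss> i)" for i
    by (simp add: tangent_space_form_def \<nn>0_def a_def mink_simps dd dq sq ss m
        mink_sym[of \<qq> "\<ss> i"])
  \<comment> \<open>One such vertex suffices for \<open>N > 0\<close>, because \<open>N\<close> is
    the norm at every vertex.\<close>
  have "\<exists>i. \<nn>0 i \<noteq> 0"
  proof (rule ccontr)
    assume "\<not> ?thesis"
    then have "\<ss>_dual i = (- a) *\<^sub>R \<ss> i + m *\<^sub>R \<qq>" for i
      by (cases i) (simp add: \<nn>0_def eq_diff_eq)
    then show False
      using nondegenerate koenigs_dual_homothetic_degenerate[OF dual] by blast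
  qed
  then have "N > 0"
    using mink_tangent_pos[OF affine_projection(1) tangent] norm by metis
  define \<mu> where "\<mu> = 1 / sqrt N"
  define \<nn> where "\<nn> = (\<lambda>i. \<mu> *\<^sub>R \<nn>0 i)"
  have "\<mu> * \<mu> * N = 1"
    using \<open>N > 0\<close> by (simp add: \<mu>_def)
  then have "mink (\<nn> i) (\<nn> i) = 1" for i
    by (simp add: \<nn>_def mink_simps norm)
  moreover have "\<nn> i \<in> tangent_space_form \<qq> (\<ss> i)" for i
    using tangent[of i] by (simp add: \<nn>_def tangent_space_form_def mink_simps)
  moreover have "\<exists>k. diff \<nn> i j + k *\<^sub>R diff \<ss> i j = 0" if "edge i j" for i j
  proof -
    obtain c where "diff \<ss>_dual i j = c *\<^sub>R diff \<ss> i j"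
      using edge_dual[OF \<open>edge i j\<close>] by blast
    then have "diff \<nn> i j + (- \<mu> * (c + a)) *\<^sub>R diff \<ss> i j = 0"
      by (simp add: \<nn>_def \<nn>0_def diff_simps algebra_simps)
    then show ?thesis by blast
  qed
  ultimately have "gauss_map \<qq> \<ss> \<nn>"
    by (simp add: gauss_map_def)
  \<comment> \<open>The constant vector \<open>m *\<^sub>R \<qq>\<close> drops out of the
    differences, which leaves only the part \<open>\<mu> * a\<close> along
    \<open>\<ss>\<close>.\<close>
  moreover have "mixed_area \<nn> \<ss> i j k l = - (- \<mu> * a) *\<^sub>R mixed_area \<ss> \<ss> i j k l"
    if "face i j k l" for i j k l
    unfolding \<nn>_def \<nn>0_def mixed_area_simps
    using koenigs_dual_mixed_area_zero[OF dual that] by simp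
  ultimately show ?thesis by blast
qed

end
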